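(* Let $\mathbb{T}$ be a time scale, let $a,b\in\mathbb{T}$ with $a<b$, and let $f:[a,b]_{\mathbb{T}}\to\mathbb{R}_{\mathcal{I}}$ be such that $f(t)=[\underline{f}(t),\overline{f}(t)]$ for all $t\in[a,b]_{\mathbb{T}}$. Then, for every $t\in[a,b)_{\mathbb{T}}$, $f$ is $ID$ $\Delta$-integrable on $[t,\sigma(t)]_{\mathbb{T}}$ and $$(ID)\int_{t}^{\sigma(t)}f(s)\,\Delta s=\big[\mu(t)\underline{f}(t),\ \mu(t)\overline{f}(t)\big].$$
   Context: A time scale $\mathbb{T}$ is a nonempty closed subset of $\mathbb{R}$. For $a,b\in\mathbb{T}$, $[a,b]_{\mathbb{T}}=\{t\in\mathbb{T}:a\le t\le b\}$ and $[a,b)_{\mathbb{T}}=\{t\in\mathbb{T}:a\le t<b\}$. The forward jump operator is $\sigma(t)=\inf\{s\in\mathbb{T}:s>t\}$ (with $\sigma(\sup\mathbb{T})=\sup\mathbb{T}$ if this is finite), and the graininess is $\mu(t)=\sigma(t)-t$. $\mathbb{R}_{\mathcal{I}}$ is the set of nonempty compact intervals $[\underline{u},\overline{u}]\subset\mathbb{R}$, $\underline{u}\le\overline{u}$ (degenerate intervals allowed). A division of $[a,b]_{\mathbb{T}}$ is a finite set $D=\{a=t_0<t_1<\cdots<t_n=b\}\subseteq[a,b]_{\mathbb{T}}$. For $f=[\underline{f},\overline{f}]$ put $m_i=\inf\{\underline{f}(t):t\in[t_{i-1},t_i)_{\mathbb{T}}\}$, $M_i=\sup\{\overline{f}(t):t\in[t_{i-1},t_i)_{\mathbb{T}}\}$,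 $L(\underline{f},D)=\sum_{i=1}^n m_i(t_i-t_{i-1})$, $U(\overline{f},D)=\sum_{i=1}^n M_i(t_i-t_{i-1})$. The lower Darboux $\Delta$-integral of $\underline{f}$ is $\sup_D L(\underline{f},D)$ and the upper Darboux $\Delta$-integral of $\overline{f}$ is $\inf_D U(\overline{f},D)$, over all divisions $D$ of $[a,b]_{\mathbb{T}}$. The function $f$ is $ID$ $\Delta$-integrable on $[a,b]_{\mathbb{T}}$ if these two numbers are finite, and then $$(ID)\int_a^b f(t)\Delta t=\Big[\sup_D L(\underline{f},D),\ \inf_D U(\overline{f},D)\Big].$$ On a one-point interval $[t,t]_{\mathbb{T}}$ the integral is $[0,0]$. *)

theory Defs
  imports "HOL-Library.Extended_Real" "HOL-Library.Interval"
begin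

definition time_scale :: "real set \<Rightarrow> bool" where
  "time_scale T \<longleftrightarrow> closed T \<and> T \<noteq> {}"

definition ts_cc :: "real set \<Rightarrow> real \<Rightarrow> real \<Rightarrow> real set" where
  "ts_cc T a b = {t \<in> T. a \<le> t \<and> t \<le> b}"

definition ts_co :: "real set \<Rightarrow> real \<Rightarrow> real \<Rightarrow> real set" where
  "ts_co T a b = {t \<in> T. a \<le> t \<and> t < b}"

text \<open>For \<open>t \<in> T\<close>, the second case below occurs exactly when \<open>t = sup T\<close>.\<close>

definition forward_jump :: "real set \<Rightarrow> real \<Rightarrow> real" where
  "forward_jump T t = (if \<exists>s\<in>T. s > t then Inf {s \<in> T. s > t} else t)"

definition graininess :: "real set \<Rightarrow> real \<Rightarrow> real" where
  "graininess T t = forward_jump T t - t"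

text \<open>
  The case \<open>a = b\<close> is included: the only division of a one-point interval
  is \<open>{a}\<close>, with \<open>n = 0\<close> subintervals and hence zero Darboux sums.
\<close>

definition division :: "real set \<Rightarrow> real \<Rightarrow> real \<Rightarrow> real set \<Rightarrow> bool" where
  "division T a b D \<longleftrightarrow> finite D \<and> D \<subseteq> ts_cc T a b \<and> a \<in> D \<and> b \<in> D"

text \<open>The points \<open>t\<^sub>0 < t\<^sub>1 < \<dots> < t\<^sub>n\<close> of \<open>D\<close>, where \<open>n = card D - 1\<close>.\<close>

definition div_pt :: "real set \<Rightarrow> nat \<Rightarrow> real" where
  "div_pt D i = sorted_list_of_set D ! i"

text \<open>
  The infima \<open>m\<^sub>i\<close> may be \<open>-\<infinity>\<close> and the suprema \<open>M\<^sub>i\<close> may be \<open>\<infinity>\<close>, so the sums are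
  extended reals. Each \<open>[t\<^sub>i\<^sub>-\<^sub>1, t\<^sub>i)\<close> contains \<open>t\<^sub>i\<^sub>-\<^sub>1\<close>, so \<open>m\<^sub>i < \<infinity>\<close> and
  \<open>M\<^sub>i > -\<infinity>\<close>, and no sum mixes \<open>\<infinity>\<close> with \<open>-\<infinity>\<close>.
\<close>

definition lower_darboux_sum :: "real set \<Rightarrow> (real \<Rightarrow> real) \<Rightarrow> real set \<Rightarrow> ereal" where
  "lower_darboux_sum T g D =
     (\<Sum>i=1..card D - 1.
        (INF t\<in>ts_co T (div_pt D (i - 1)) (div_pt D i). ereal (g t))
        * ereal (div_pt D i - div_pt D (i - 1)))"

definition upper_darboux_sum :: "real set \<Rightarrow> (real \<Rightarrow> real) \<Rightarrow> real set \<Rightarrow> ereal" where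
  "upper_darboux_sum T g D =
     (\<Sum>i=1..card D - 1.
        (SUP t\<in>ts_co T (div_pt D (i - 1)) (div_pt D i). ereal (g t))
        * ereal (div_pt D i - div_pt D (i - 1)))"

definition lower_darboux_integral :: "real set \<Rightarrow> (real \<Rightarrow> real) \<Rightarrow> real \<Rightarrow> real \<Rightarrow> ereal" where
  "lower_darboux_integral T g a b = (SUP D\<in>{D. division T a b D}. lower_darboux_sum T g D)"

definition upper_darboux_integral :: "real set \<Rightarrow> (real \<Rightarrow> real) \<Rightarrow> real \<Rightarrow> real \<Rightarrow> ereal" where
  "upper_darboux_integral T g a b = (INF D\<in>{D. division T a b D}. upper_darboux_sum T g D)"

definition ID_integrable :: "real set \<Rightarrow> (real \<Rightarrow> real interval) \<Rightarrow> real \<Rightarrow> real \<Rightarrow> bool" where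
  "ID_integrable T f a b \<longleftrightarrow>
     \<bar>lower_darboux_integral T (\<lambda>t. lower (f t)) a b\<bar> \<noteq> \<infinity> \<and>
     \<bar>upper_darboux_integral T (\<lambda>t. upper (f t)) a b\<bar> \<noteq> \<infinity>"

text \<open>
  Meaningful only for integrable \<open>f\<close>. The interval is described by its endpoints because
  \<^const>\<open>Ivl\<close> silently replaces its first argument by the minimum of both.
\<close>

definition ID_integral :: "real set \<Rightarrow> (real \<Rightarrow> real interval) \<Rightarrow> real \<Rightarrow> real \<Rightarrow> real interval" where
  "ID_integral T f a b =
     (THE I. ereal (lower I) = lower_darboux_integral T (\<lambda>t. lower (f t)) a b \<and>
             ereal (upper I) = upper_darboux_integral T (\<lambda>t. upper (f t)) a b)"

end

theory Submission
  imports Defs "HOL-Analysis.Elementary_Metric_Spaces"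
begin

text \<open>
  No point of the time scale lies strictly between \<open>t\<close> and its forward jump \<open>\<sigma>(t)\<close>, which itself
  belongs to the time scale because the latter is closed. Hence \<open>{t, \<sigma>(t)}\<close> is the only division of
  \<open>[t, \<sigma>(t)]\<close>, and the supremum and infimum defining the Darboux integrals are taken over a single
  Darboux sum.

  If \<open>t < \<sigma>(t)\<close>, that sum has one term, and \<open>[t, \<sigma>(t))\<close> contains only the point \<open>t\<close>; so the sum is
  \<open>\<mu>(t) g(t)\<close>, for the lower and the upper integral alike. If \<open>t = \<sigma>(t)\<close>, the sum is empty and
  \<open>\<mu>(t) = 0\<close>, so the same formula holds. The lemma \<open>darboux_integrals_consecutive\<close> gives this for
  any two points of the time scale with nothing in between, and it is applied to both endpoint
  functions of \<open>f\<close>.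
\<close>

lemma forward_jump_ge: "t \<le> forward_jump T t"
  by (auto simp: forward_jump_def intro: cInf_greatest)

lemma forward_jump_le:
  assumes "s \<in> T" "t < s"
  shows "forward_jump T t \<le> s"
proof -
  have "bdd_below {s \<in> T. s > t}"
    by (rule bdd_belowI[of _ t]) auto
  then show ?thesis
    using assms by (auto simp: forward_jump_def intro: cInf_lower)
qed

lemma forward_jump_mem:
  assumes "closed T" "t \<in> T"
  shows "forward_jump T t \<in> T"
proof (cases "\<exists>s\<in>T. s > t")
  case True
  have "Inf {s \<in> T. s > t} \<in> closure {s \<in> T. s > t}"
    using True by (intro closure_contains_Inf bdd_belowI[of _ t]) auto
  also have "\<dots> \<subseteq> T"
    using \<open>closed T\<close> by (intro closure_minimal) auto
  finally show ?thesis
    using True by (simp add: forward_jump_def)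
qed (use assms in \<open>auto simp: forward_jump_def\<close>)

lemma division_consecutive_iff:
  assumes "c \<in> T" "d \<in> T" "c \<le> d" "T \<inter> {c<..<d} = {}"
  shows "division T c d D \<longleftrightarrow> D = {c, d}"
proof -
  have "ts_cc T c d = {c, d}"
    using assms by (force simp: ts_cc_def)
  then show ?thesis
    by (auto simp: division_def)
qed

lemma darboux_integrals_consecutive:
  assumes "c \<in> T" "d \<in> T" "c \<le> d" "T \<inter> {c<..<d} = {}"
  shows "lower_darboux_integral T g c d = ereal ((d - c) * g c)"
    and "upper_darboux_integral T g c d = ereal ((d - c) * g c)"
proof -
  have sums: "lower_darboux_sum T g {c, d} = ereal ((d - c) * g c) \<and>
        upper_darboux_sum T g {c, d} = ereal ((d - c) * g c)"
  proof (cases "c = d")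
    case True
    then show ?thesis
      by (simp add: lower_darboux_sum_def upper_darboux_sum_def zero_ereal_def)
  next
    case False
    then have "c < d"
      using \<open>c \<le> d\<close> by simp
    then have "sorted_list_of_set {c, d} = [c, d]"
      using sorted_list_of_set.idem_if_sorted_distinct[of "[c, d]"] by simp
    then have pts: "div_pt {c, d} 0 = c" "div_pt {c, d} (Suc 0) = d"
      by (auto simp: div_pt_def)
    have "ts_co T c d = {c}"
      using assms \<open>c < d\<close> by (force simp: ts_co_def)
    then show ?thesis
      using \<open>c < d\<close>
      by (simp add: lower_darboux_sum_def upper_darboux_sum_def pts mult.commute)
  qed
  have "{D. division T c d D} = {{c, d}}"
    using division_consecutive_iff[OF assms] by auto
  then show "lower_darboux_integral T g c d = ereal ((d - c) * g c)"
    and "upper_darboux_integral T g c d = ereal ((d - c) * g c)"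
    using sums by (simp_all add: lower_darboux_integral_def upper_darboux_integral_def)
qed

lemma
  fixes x y :: "'a::linorder"
  assumes "x \<le> y"
  shows lower_Ivl: "lower (Ivl x y) = x"
    and upper_Ivl: "upper (Ivl x y) = y"
  using assms by (simp_all add: lower.rep_eq upper.rep_eq Ivl.rep_eq)

lemma ID_integral_eqI:
  assumes "lower_darboux_integral T (\<lambda>t. lower (f t)) a b = ereal (lower I)"
    and "upper_darboux_integral T (\<lambda>t. upper (f t)) a b = ereal (upper I)"
  shows "ID_integrable T f a b \<and> ID_integral T f a b = I"
proof
  show "ID_integrable T f a b"
    using assms by (simp add: ID_integrable_def)
  show "ID_integral T f a b = I"
    unfolding ID_integral_def using assms by (intro the_equality) (auto simp: interval_eq_iff)
qed

theorem theorem1: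
  fixes T :: "real set" and a b :: real and f :: "real \<Rightarrow> real interval"
    and f_lo f_up :: "real \<Rightarrow> real"
  assumes "time_scale T"
    and "a \<in> T" and "b \<in> T" and "a < b"
    and "\<forall>t\<in>ts_cc T a b. f_lo t \<le> f_up t \<and> f t = Ivl (f_lo t) (f_up t)"
  shows "\<forall>t\<in>ts_co T a b.
           ID_integrable T f t (forward_jump T t) \<and>
           ID_integral T f t (forward_jump T t) =
             Ivl (graininess T t * f_lo t) (graininess T t * f_up t)"
proof
  fix t assume "t \<in> ts_co T a b"
  then have t: "t \<in> T" "t \<in> ts_cc T a b"
    by (auto simp: ts_co_def ts_cc_def)
  let ?d = "forward_jump T t"
  let ?I = "Ivl (graininess T t * f_lo t) (graininess T t * f_up t)"
  have le: "f_lo t \<le> f_up t" and f: "f t = Ivl (f_lo t) (f_up t)"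
    using assms(5) t by auto
  have "?d \<in> T"
    using assms(1) t by (intro forward_jump_mem) (auto simp: time_scale_def)
  moreover have "T \<inter> {t<..<?d} = {}"
    by (auto dest: forward_jump_le)
  ultimately have
    "lower_darboux_integral T g t ?d = ereal (graininess T t * g t)"
    "upper_darboux_integral T g t ?d = ereal (graininess T t * g t)" for g
    using darboux_integrals_consecutive[of t T ?d g] t forward_jump_ge[of t T]
    by (auto simp: graininess_def)
  \<comment> \<open>Since \<open>\<mu>(t) \<ge> 0\<close>, scaling by it keeps the endpoints of \<open>f t\<close> in order.\<close>
  moreover have "graininess T t * f_lo t \<le> graininess T t * f_up t"
    using le forward_jump_ge[of t T] by (intro mult_left_mono) (auto simp: graininess_def)
  ultimately show "ID_integrable T f t ?d \<and> ID_integral T f t ?d = ?I"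
    using le by (intro ID_integral_eqI) (simp_all add: f lower_Ivl upper_Ivl)
qed

end
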